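(* Let $\mathbb{K}$ be an associative ring with unity (not necessarily commutative). Let $P$ be any finite poset. Let $f\in\mathbb{K}^{\widehat{P}}$ be a $\mathbb{K}$-labeling of $P$ such that $Rf\neq\bot$, where $R$ is birational rowmotion of $P$. Let $a=f(0)$ and $b=f(1)$. Assume that $(Rf)(u)$ is invertible for every $u\in\widehat{P}$ with $u\gtrdot 0$. Then $$b\cdot\sum_{\substack{u\in\widehat{P};\\ u\gtrdot 0}}\big((Rf)(u)\big)^{-1}\cdot a=\sum_{\substack{u\in\widehat{P};\\ u\lessdot 1}}f(u).$$
   Context: $\mathbb{K}$ is a fixed associative ring with unity, not necessarily commutative. An element is invertible if it has a two-sided inverse $x^{-1}$. Extended poset. For a finite poset $P$, $\widehat{P}$ is the poset on the disjoint union $P\sqcup\{0,1\}$ in which $u\le v$ iff ($u,v\in P$ and $u\le v$ in $P$) or $u=0$ or $v=1$. Write $u\lessdot v$ (equivalently $v\gtrdot u$) if $u<v$ and no $w$ satisfies $u<w<v$ (in $\widehat{P}$). Labelings and partial maps. A $\mathbb{K}$-labeling of $P$ is a map $f:\widehat{P}\to\mathbb{K}$; the set of these is $\mathbb{K}^{\widehat{P}}$. A partial map $F:X\dashrightarrow Y$ is a map $X\to Y\sqcup\{\bot\}$, where $\bot$ means "undefined"; it is extended by $F(\bot)=\bot$, and partial maps are composed accordingly. Toggles. For $v\in P$, the toggle $T_v:\mathbb{K}^{\widehat{P}}\dashrightarrow\mathbb{K}^{\widehat{P}}$ is defined by $(T_vf)(w)=f(w)$ for $w\ne v$ and $$(T_vf)(v)=\Big(\sum_{u\in\widehat{P},\,u\lessdot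 v}f(u)\Big)\cdot f(v)^{-1}\cdot\Big(\sum_{u\in\widehat{P},\,u\gtrdot v}f(u)^{-1}\Big)^{-1};$$ if any inverse in this formula does not exist, then $T_vf:=\bot$. Birational rowmotion. $R:=T_{v_1}\circ T_{v_2}\circ\cdots\circ T_{v_m}:\mathbb{K}^{\widehat{P}}\dashrightarrow\mathbb{K}^{\widehat{P}}$, where $(v_1,\ldots,v_m)$ is any linear extension of $P$ (a list of all elements of $P$, each exactly once, such that $v_i<v_j$ implies $i<j$); so the toggles at larger elements are applied first. This partial map does not depend on the choice of linear extension. *)

theory Defs
  imports Main
begin

text \<open>
  The sort \<open>{ring, monoid_mult}\<close> is that of associative rings with unity; unlike \<open>ring_1\<close> it does
  not impose \<open>0 \<noteq> 1\<close>. The type-class \<open>inverse\<close> is only available for division rings, hence the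
  following two-sided inverse.
\<close>

definition is_inverse :: "'k::{ring, monoid_mult} \<Rightarrow> 'k \<Rightarrow> bool" where
  "is_inverse x y \<longleftrightarrow> x * y = 1 \<and> y * x = 1"

definition invertible :: "'k::{ring, monoid_mult} \<Rightarrow> bool" where
  "invertible x \<longleftrightarrow> (\<exists>y. is_inverse x y)"

text \<open>Unspecified unless \<open>x\<close> is invertible.\<close>

definition inv_of :: "'k::{ring, monoid_mult} \<Rightarrow> 'k" where
  "inv_of x = (THE y. is_inverse x y)"

lemma inv_of_eqI:
  assumes "is_inverse x y"
  shows "inv_of x = y"
  unfolding inv_of_def
proof (rule the_equality)
  show "is_inverse x y" by (fact assms)
next
  fix z assume "is_inverse x z"
  then have "z = z * (x * y)" using assms by (simp add: is_inverse_def)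
  also have "\<dots> = y" using \<open>is_inverse x z\<close> by (simp add: is_inverse_def mult.assoc[symmetric])
  finally show "z = y" .
qed

text \<open>
  A finite poset is a finite carrier \<open>P\<close> with a relation \<open>r\<close> such that \<open>partial_order_on P r\<close>;
  \<open>(u, v) \<in> r\<close> means \<open>u \<le> v\<close>. A carrier set is used so that the empty poset is included.
\<close>

datatype 'p ext = Zero | Elem 'p | One

definition ext_carrier :: "'p set \<Rightarrow> 'p ext set" where
  "ext_carrier P = insert Zero (insert One (Elem ` P))"

definition ext_rel :: "'p set \<Rightarrow> 'p rel \<Rightarrow> 'p ext rel" where
  "ext_rel P r = {(u, v). u \<in> ext_carrier P \<and> v \<in> ext_carrier P \<and>
     ((\<exists>p q. u = Elem p \<and> v = Elem q \<and> (p, q) \<in> r) \<or> u = Zero \<or> v = One)}"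

definition less_in :: "'a rel \<Rightarrow> 'a \<Rightarrow> 'a \<Rightarrow> bool" where
  "less_in s u v \<longleftrightarrow> (u, v) \<in> s \<and> u \<noteq> v"

definition covered_in :: "'a rel \<Rightarrow> 'a \<Rightarrow> 'a \<Rightarrow> bool" where
  "covered_in s u v \<longleftrightarrow> less_in s u v \<and> (\<nexists>w. less_in s u w \<and> less_in s w v)"

definition lower_covers :: "'p set \<Rightarrow> 'p rel \<Rightarrow> 'p ext \<Rightarrow> 'p ext set" where
  "lower_covers P r v = {u \<in> ext_carrier P. covered_in (ext_rel P r) u v}"

definition upper_covers :: "'p set \<Rightarrow> 'p rel \<Rightarrow> 'p ext \<Rightarrow> 'p ext set" where
  "upper_covers P r v = {u \<in> ext_carrier P. covered_in (ext_rel P r) v u}"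

text \<open>
  Labelings are functions on the whole type \<open>'p ext\<close>; their values outside \<open>ext_carrier P\<close>
  are never read and never changed. Partial maps are the library's \<open>'a \<rightharpoonup> 'b\<close>, composed by
  \<open>\<circ>\<^sub>m\<close>, with \<open>None\<close> for ``undefined''.
\<close>

type_synonym ('p, 'k) labeling = "'p ext \<Rightarrow> 'k"

definition toggle ::
  "'p set \<Rightarrow> 'p rel \<Rightarrow> 'p \<Rightarrow> ('p, 'k::{ring, monoid_mult}) labeling \<rightharpoonup> ('p, 'k) labeling" where
  "toggle P r v f =
    (if invertible (f (Elem v)) \<and>
        (\<forall>u \<in> upper_covers P r (Elem v). invertible (f u)) \<and>
        invertible (\<Sum>u \<in> upper_covers P r (Elem v). inv_of (f u))
     then Some (f(Elem v :=
        (\<Sum>u \<in> lower_covers P r (Elem v). f u) * inv_of (f (Elem v)) *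
        inv_of (\<Sum>u \<in> upper_covers P r (Elem v). inv_of (f u))))
     else None)"

definition linear_extension :: "'p set \<Rightarrow> 'p rel \<Rightarrow> 'p list \<Rightarrow> bool" where
  "linear_extension P r vs \<longleftrightarrow> distinct vs \<and> set vs = P \<and>
     (\<forall>i < length vs. \<forall>j < length vs. less_in r (vs ! i) (vs ! j) \<longrightarrow> i < j)"

text \<open>
  \<open>rowmotion P r [v\<^sub>1, \<dots>, v\<^sub>m]\<close> is the composition of the toggles at \<open>v\<^sub>1, \<dots>, v\<^sub>m\<close>, the toggle at
  \<open>v\<^sub>m\<close> being applied first. It is birational rowmotion whenever the list is a linear extension
  of the poset; statements about rowmotion quantify over all linear extensions.
\<close>

definition rowmotion ::
  "'p set \<Rightarrow> 'p rel \<Rightarrow> 'p list \<Rightarrow> ('p, 'k::{ring, monoid_mult}) labeling \<rightharpoonup> ('p, 'k) labeling" where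
  "rowmotion P r vs = foldr (\<lambda>v F. toggle P r v \<circ>\<^sub>m F) vs Some"

lemma ex_linear_extension:
  assumes "finite P" "partial_order_on P r"
  shows "\<exists>vs. linear_extension P r vs"
proof -
  have tr: "trans r" and an: "antisym r" using partial_order_onD[OF assms(2)] by auto
  have "\<exists>vs. linear_extension A r vs" if "finite A" for A
    using that
  proof (induction A rule: finite_psubset_induct)
    case (psubset A)
    show ?case
    proof (cases "A = {}")
      case True
      then show ?thesis by (auto simp: linear_extension_def intro!: exI[of _ "[]"])
    next
      case False
      have "\<exists>m\<in>A. \<forall>x\<in>A. x \<noteq> m \<longrightarrow> \<not> less_in r m x"
      proof (rule Finite_Set.bex_max_element[OF psubset.hyps _ _ False])
        show "asymp_on A (less_in r)"
          using an by (auto intro!: asymp_onI simp: less_in_def antisym_def)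
        show "transp_on A (less_in r)"
          using an tr unfolding transp_on_def less_in_def antisym_def trans_def by blast
      qed
      then obtain m where m: "m \<in> A" "\<forall>x\<in>A. x \<noteq> m \<longrightarrow> \<not> less_in r m x"
        by blast
      then have "A - {m} \<subset> A" by blast
      then obtain vs where vs: "linear_extension (A - {m}) r vs"
        using psubset.IH by blast
      have nm: "\<not> less_in r m x" if "x \<in> A" for x
        using m that by (auto simp: less_in_def)
      have "linear_extension A r (vs @ [m])"
        unfolding linear_extension_def
      proof (intro conjI allI impI)
        show "distinct (vs @ [m])" "set (vs @ [m]) = A"
          using vs m by (auto simp: linear_extension_def)
        fix i j
        assume ij: "i < length (vs @ [m])" "j < length (vs @ [m])"
          and less: "less_in r ((vs @ [m]) ! i) ((vs @ [m]) ! j)"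
        have "(vs @ [m]) ! j \<in> A"
          using nth_mem[OF ij(2)] \<open>set (vs @ [m]) = A\<close> by blast
        then have i: "i < length vs"
          using less nm ij(1) by (cases "i = length vs") auto
        show "i < j"
        proof (cases "j = length vs")
          case False
          then have "j < length vs" using ij(2) by simp
          then show ?thesis
            using i less vs by (simp add: linear_extension_def nth_append)
        qed (use i in simp)
      qed
      then show ?thesis by blast
    qed
  qed
  then show ?thesis using assms(1) by blast
qed

end

theory Submission
  imports Defs
begin

text \<open>
  Put \<open>g = Rf\<close>. Multiplying out the definition of the toggle at \<open>v \<in> P\<close> gives
  \<open>(\<Sum>u \<gtrdot> v. g(u)\<^sup>-\<^sup>1) f(v) = g(v)\<^sup>-\<^sup>1 (\<Sum>u \<lessdot> v. f(u))\<close>. Summed over \<open>v \<in> P\<close>, both sides are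
  sums of \<open>g(y)\<^sup>-\<^sup>1 f(x)\<close> over covering pairs \<open>x \<lessdot> y\<close>, and only the pairs with \<open>x = 0\<close> or \<open>y = 1\<close>
  do not cancel: \<open>(\<Sum>u \<gtrdot> 0. g(u)\<^sup>-\<^sup>1) a = b\<^sup>-\<^sup>1 (\<Sum>u \<lessdot> 1. f(u))\<close>. Every \<open>u \<noteq> 0\<close> covers something,
  so all inverses involved exist, either because the toggles are defined or, for \<open>u \<gtrdot> 0\<close>, by
  assumption.
\<close>

lemma is_inverse_inv_of: "invertible x \<Longrightarrow> is_inverse x (inv_of x)"
  unfolding invertible_def using inv_of_eqI by metis

lemma inv_of_right: "invertible x \<Longrightarrow> x * inv_of x = 1"
  and inv_of_left: "invertible x \<Longrightarrow> inv_of x * x = 1"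
  using is_inverse_inv_of[of x] by (simp_all add: is_inverse_def)

lemma finite_ext_carrier: "finite P \<Longrightarrow> finite (ext_carrier P)"
  by (simp add: ext_carrier_def)

lemma partial_order_on_ext_rel:
  assumes "partial_order_on P r"
  shows "partial_order_on (ext_carrier P) (ext_rel P r)"
proof -
  have rf: "refl_on P r" and tr: "trans r" and an: "antisym r"
    using partial_order_onD[OF assms] by auto
  have "refl_on (ext_carrier P) (ext_rel P r)"
    using rf by (auto simp: refl_on_def ext_carrier_def ext_rel_def)
  moreover have "trans (ext_rel P r)"
    using tr by (fastforce simp: trans_def ext_rel_def)
  moreover have "antisym (ext_rel P r)"
    using an by (auto simp: antisym_def ext_rel_def)
  ultimately show ?thesis
    by (auto simp: partial_order_on_def preorder_on_def ext_rel_def)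
qed

text \<open>A maximal element of the finite nonempty set of elements strictly below \<open>y\<close>
  is covered by \<open>y\<close>.\<close>

lemma ex_covered_in:
  assumes "finite A" "partial_order_on A s" "x \<in> A" "less_in s x y"
  shows "\<exists>u\<in>A. covered_in s u y"
proof -
  have tr: "trans s" and an: "antisym s" and ss: "s \<subseteq> A \<times> A"
    using assms(2) by (auto simp: partial_order_on_def preorder_on_def)
  let ?B = "{u \<in> A. less_in s u y}"
  have "\<exists>m\<in>?B. \<forall>u\<in>?B. u \<noteq> m \<longrightarrow> \<not> less_in s m u"
  proof (rule Finite_Set.bex_max_element)
    show "finite ?B" "?B \<noteq> {}" using assms by auto
    show "asymp_on ?B (less_in s)"
      using an by (auto intro!: asymp_onI simp: less_in_def antisym_def)
    show "transp_on ?B (less_in s)"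
      using an tr unfolding transp_on_def less_in_def antisym_def trans_def by blast
  qed
  then obtain m where "m \<in> ?B" "\<forall>u\<in>?B. u \<noteq> m \<longrightarrow> \<not> less_in s m u" by blast
  then show ?thesis
    using ss by (intro bexI[of _ m]) (auto simp: covered_in_def less_in_def)
qed

lemma lower_covers_nonempty:
  assumes "finite P" "partial_order_on P r" "u \<in> ext_carrier P" "u \<noteq> Zero"
  shows "lower_covers P r u \<noteq> {}"
proof -
  have "less_in (ext_rel P r) Zero u"
    using assms(3,4) by (auto simp: less_in_def ext_rel_def ext_carrier_def)
  then show ?thesis
    using ex_covered_in[OF finite_ext_carrier[OF assms(1)] partial_order_on_ext_rel[OF assms(2)],
        of Zero u]
    by (auto simp: lower_covers_def ext_carrier_def)
qed

lemma lower_covers_Zero: "lower_covers P r Zero = {}"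
  by (auto simp: lower_covers_def covered_in_def less_in_def ext_rel_def)

lemma upper_covers_One: "upper_covers P r One = {}"
  by (auto simp: upper_covers_def covered_in_def less_in_def ext_rel_def)

lemma lower_covers_iff_upper_covers:
  "u \<in> ext_carrier P \<Longrightarrow> v \<in> lower_covers P r u \<longleftrightarrow> v \<in> ext_carrier P \<and> u \<in> upper_covers P r v"
  by (auto simp: lower_covers_def upper_covers_def)

lemma less_in_of_covers:
  "Elem p \<in> lower_covers P r (Elem q) \<Longrightarrow> less_in r p q"
  "Elem q \<in> upper_covers P r (Elem p) \<Longrightarrow> less_in r p q"
  by (auto simp: lower_covers_def upper_covers_def covered_in_def less_in_def ext_rel_def)

text \<open>Double counting: both sides run over all covering pairs, with \<open>u\<close> covering
  \<open>v\<close>.\<close>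

lemma sum_upper_covers_eq_sum_lower_covers:
  fixes h :: "'p ext \<Rightarrow> 'p ext \<Rightarrow> 'k::comm_monoid_add"
  assumes "finite P"
  shows "(\<Sum>v\<in>ext_carrier P. \<Sum>u\<in>upper_covers P r v. h u v)
       = (\<Sum>u\<in>ext_carrier P. \<Sum>v\<in>lower_covers P r u. h u v)"
  unfolding upper_covers_def lower_covers_def
  by (rule sum.swap_restrict) (simp_all add: finite_ext_carrier assms)

lemma sum_ext_carrier:
  fixes h :: "'p ext \<Rightarrow> 'k::comm_monoid_add"
  assumes "finite P"
  shows "(\<Sum>u\<in>ext_carrier P. h u) = h Zero + (h One + (\<Sum>p\<in>P. h (Elem p)))"
proof -
  have "(\<Sum>u\<in>Elem ` P. h u) = (\<Sum>p\<in>P. h (Elem p))"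
    by (subst sum.reindex) (auto simp: inj_on_def)
  then show ?thesis
    using assms by (subst ext_carrier_def) (auto simp: image_iff)
qed

text \<open>The toggle formula with two labelings: \<open>f\<close> is read at \<open>v\<close> and
  below, \<open>g\<close> above. In this form one pair, the initial and the final labeling, can
  satisfy it at all \<open>v\<close> simultaneously.\<close>

definition toggled ::
  "'p set \<Rightarrow> 'p rel \<Rightarrow> ('p, 'k::{ring, monoid_mult}) labeling \<Rightarrow> ('p, 'k) labeling \<Rightarrow> 'p \<Rightarrow> bool" where
  "toggled P r f g v \<longleftrightarrow>
     invertible (f (Elem v)) \<and>
     (\<forall>u\<in>upper_covers P r (Elem v). invertible (g u)) \<and>
     invertible (\<Sum>u\<in>upper_covers P r (Elem v). inv_of (g u)) \<and>
     g (Elem v) = (\<Sum>u\<in>lower_covers P r (Elem v). f u) * inv_of (f (Elem v)) *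
        inv_of (\<Sum>u\<in>upper_covers P r (Elem v). inv_of (g u))"

lemma toggled_cong:
  assumes "f (Elem v) = f' (Elem v)" "g (Elem v) = g' (Elem v)"
    and "\<And>u. u \<in> lower_covers P r (Elem v) \<Longrightarrow> f u = f' u"
    and "\<And>u. u \<in> upper_covers P r (Elem v) \<Longrightarrow> g u = g' u"
  shows "toggled P r f g v \<longleftrightarrow> toggled P r f' g' v"
proof -
  have "(\<Sum>u\<in>lower_covers P r (Elem v). f u) = (\<Sum>u\<in>lower_covers P r (Elem v). f' u)"
    "(\<Sum>u\<in>upper_covers P r (Elem v). inv_of (g u)) = (\<Sum>u\<in>upper_covers P r (Elem v). inv_of (g' u))"
    using assms by (auto intro!: sum.cong)
  then show ?thesis using assms by (simp add: toggled_def)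
qed

lemma toggle_eq_Some:
  assumes "toggle P r v f = Some g"
  shows "toggled P r f g v" "w \<noteq> Elem v \<Longrightarrow> g w = f w"
proof -
  show *: "w \<noteq> Elem v \<Longrightarrow> g w = f w" for w
    using assms by (auto simp: toggle_def split: if_splits)
  have "toggled P r f g v \<longleftrightarrow>
     invertible (f (Elem v)) \<and>
     (\<forall>u\<in>upper_covers P r (Elem v). invertible (f u)) \<and>
     invertible (\<Sum>u\<in>upper_covers P r (Elem v). inv_of (f u)) \<and>
     g (Elem v) = (\<Sum>u\<in>lower_covers P r (Elem v). f u) * inv_of (f (Elem v)) *
        inv_of (\<Sum>u\<in>upper_covers P r (Elem v). inv_of (f u))"
  proof -
    \<comment> \<open>No element covers itself, so the toggle at \<open>v\<close> leaves the labels
      on the upper covers of \<open>v\<close> alone.\<close>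
    have up: "g u = f u" if "u \<in> upper_covers P r (Elem v)" for u
      using that by (intro *) (auto simp: upper_covers_def covered_in_def less_in_def)
    then have "(\<Sum>u\<in>upper_covers P r (Elem v). inv_of (g u)) = (\<Sum>u\<in>upper_covers P r (Elem v). inv_of (f u))"
      by (intro sum.cong) auto
    then show ?thesis using up by (simp add: toggled_def)
  qed
  then show "toggled P r f g v"
    using assms by (auto simp: toggle_def split: if_splits)
qed

text \<open>
  When \<open>v\<close> is toggled, the elements above it already carry their new labels and those below it
  still carry their old ones. The list need not exhaust \<open>P\<close>, so that the induction goes through.
\<close>

lemma rowmotion_eq_Some:
  assumes "rowmotion P r vs f = Some g" "distinct vs" "sorted_wrt (\<lambda>x y. \<not> less_in r y x) vs"
  shows "(\<forall>w. w \<notin> Elem ` set vs \<longrightarrow> g w = f w) \<and> (\<forall>v\<in>set vs. toggled P r f g v)"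
  using assms
proof (induction vs arbitrary: g)
  case Nil
  then show ?case by (simp add: rowmotion_def)
next
  case (Cons v vs)
  from Cons.prems(1) obtain g' where g': "rowmotion P r vs f = Some g'"
    and t: "toggle P r v g' = Some g"
    by (auto simp: rowmotion_def map_comp_Some_iff)
  have fixed: "\<And>w. w \<notin> Elem ` set vs \<Longrightarrow> g' w = f w"
    and IH: "\<And>w. w \<in> set vs \<Longrightarrow> toggled P r f g' w"
    using Cons.IH[OF g'] Cons.prems by auto
  have sorted: "\<not> less_in r w v" if "w \<in> set vs" for w
    using Cons.prems(3) that by auto
  \<comment> \<open>The labelings \<open>g'\<close> and \<open>f\<close> can differ only on the tail
    \<open>vs\<close>, which contains neither \<open>v\<close> nor anything below
    \<open>v\<close>.\<close>
  have "toggled P r g' g v \<longleftrightarrow> toggled P r f g v"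
    using Cons.prems(2) sorted
    by (intro toggled_cong refl fixed) (auto dest: less_in_of_covers)
  then have "toggled P r f g v"
    using toggle_eq_Some(1)[OF t] by simp
  moreover have "toggled P r f g w" if w: "w \<in> set vs" for w
  proof -
    \<comment> \<open>The last toggle changes only the label at \<open>v\<close>, and
      \<open>v\<close> is neither \<open>w\<close> nor above \<open>w\<close>.\<close>
    have "toggled P r f g w \<longleftrightarrow> toggled P r f g' w"
      using Cons.prems(2) sorted[OF w] w
      by (intro toggled_cong refl toggle_eq_Some(2)[OF t]) (auto dest: less_in_of_covers)
    then show ?thesis using IH[OF w] by simp
  qed
  ultimately show ?case
    using fixed toggle_eq_Some(2)[OF t] by auto
qed

lemma linear_extension_sorted_wrt:
  "linear_extension P r vs \<Longrightarrow> sorted_wrt (\<lambda>x y. \<not> less_in r y x) vs"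
  unfolding linear_extension_def sorted_wrt_iff_nth_less
  by (metis order.strict_trans order.strict_iff_not)

lemma toggled_balance:
  assumes "toggled P r f g v" "invertible (g (Elem v))"
  shows "(\<Sum>u\<in>upper_covers P r (Elem v). inv_of (g u) * f (Elem v))
       = (\<Sum>u\<in>lower_covers P r (Elem v). inv_of (g (Elem v)) * f u)"
proof -
  define D where "D = (\<Sum>u\<in>upper_covers P r (Elem v). inv_of (g u))"
  define A where "A = (\<Sum>u\<in>lower_covers P r (Elem v). f u)"
  let ?x = "f (Elem v)" and ?y = "g (Elem v)"
  have inv: "invertible ?x" "invertible D" and y: "?y = A * inv_of ?x * inv_of D"
    using assms(1) by (simp_all add: toggled_def D_def A_def)
  \<comment> \<open>The product \<open>?y * D * ?x\<close> telescopes to \<open>A\<close>. Inverting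
    \<open>?y\<close> requires the second assumption, since \<open>A\<close> may fail to be
    invertible.\<close>
  have "D * ?x = inv_of ?y * (?y * D * ?x)"
    by (simp add: mult.assoc[symmetric] inv_of_left[OF assms(2)])
  also have "?y * D * ?x = A * inv_of ?x * (inv_of D * D) * ?x"
    by (simp only: y mult.assoc)
  also have "\<dots> = A * (inv_of ?x * ?x)"
    by (simp add: inv_of_left[OF inv(2)] mult.assoc)
  also have "\<dots> = A"
    by (simp add: inv_of_left[OF inv(1)])
  finally show ?thesis
    by (simp add: D_def A_def sum_distrib_left sum_distrib_right)
qed

theorem proposition14p1:
  fixes P :: "'p set" and r :: "'p rel" and vs :: "'p list"
    and f Rf :: "('p, 'k::{ring, monoid_mult}) labeling"
    and a b :: 'k
  assumes "finite P" and "partial_order_on P r"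
    and "linear_extension P r vs"
    and "rowmotion P r vs f = Some Rf"
    and "a = f Zero" and "b = f One"
    and "\<And>u. u \<in> upper_covers P r Zero \<Longrightarrow> invertible (Rf u)"
  shows "b * (\<Sum>u \<in> upper_covers P r Zero. inv_of (Rf u)) * a
       = (\<Sum>u \<in> lower_covers P r One. f u)"
proof -
  have vs: "set vs = P" "distinct vs"
    using assms(3) by (simp_all add: linear_extension_def)
  have fixed: "Rf w = f w" if "w \<notin> Elem ` P" for w
    using rowmotion_eq_Some[OF assms(4) vs(2) linear_extension_sorted_wrt[OF assms(3)]] vs that
    by blast
  have tog: "toggled P r f Rf v" if "v \<in> P" for v
    using rowmotion_eq_Some[OF assms(4) vs(2) linear_extension_sorted_wrt[OF assms(3)]] vs that
    by blast
  have inv: "invertible (Rf u)" if u: "u \<in> ext_carrier P" "u \<noteq> Zero" for u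
  proof -
    \<comment> \<open>If \<open>v\<close> is \<open>Zero\<close>, the hypothesis on
      \<open>Rf\<close> applies; if \<open>v\<close> lies in \<open>P\<close>, definedness of its
      toggle does; \<open>One\<close> has no upper covers.\<close>
    obtain v where "v \<in> ext_carrier P" "u \<in> upper_covers P r v"
      using lower_covers_nonempty[OF assms(1,2) u] lower_covers_iff_upper_covers[OF u(1)] by blast
    then show ?thesis
      using assms(7) tog upper_covers_One[of P r]
      by (auto simp: ext_carrier_def toggled_def)
  qed
  \<comment> \<open>Rowmotion fixes the label at \<open>One\<close>. If \<open>P\<close> is empty,
    \<open>One\<close> covers \<open>Zero\<close>, and \<open>b\<close> is invertible by the
    hypothesis on \<open>Rf\<close>.\<close>
  have b: "Rf One = b" "invertible b"
    using fixed[of One] inv[of One] assms(6) by (auto simp: ext_carrier_def image_iff)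
  define h where "h u v = inv_of (Rf u) * f v" for u v
  have balance: "(\<Sum>p\<in>P. \<Sum>u\<in>upper_covers P r (Elem p). h u (Elem p))
      = (\<Sum>p\<in>P. \<Sum>v\<in>lower_covers P r (Elem p). h (Elem p) v)"
    unfolding h_def
    by (intro sum.cong refl toggled_balance tog inv) (auto simp: ext_carrier_def)
  \<comment> \<open>Both double sums split into the terms at \<open>Zero\<close>, at
    \<open>One\<close> and over \<open>P\<close>. The parts over \<open>P\<close> agree by
    \<open>balance\<close> and cancel; of the four remaining terms, two are empty sums.\<close>
  have "(\<Sum>u\<in>upper_covers P r Zero. h u Zero) = (\<Sum>v\<in>lower_covers P r One. h One v)"
    using sum_upper_covers_eq_sum_lower_covers[OF assms(1), where r = r and h = h]
    by (simp add: sum_ext_carrier[OF assms(1)] balance upper_covers_One lower_covers_Zero)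
  then have "(\<Sum>u\<in>upper_covers P r Zero. inv_of (Rf u)) * a
      = inv_of b * (\<Sum>u\<in>lower_covers P r One. f u)"
    by (simp add: h_def b assms(5) sum_distrib_left sum_distrib_right)
  then have "b * (\<Sum>u\<in>upper_covers P r Zero. inv_of (Rf u)) * a
      = (b * inv_of b) * (\<Sum>u\<in>lower_covers P r One. f u)"
    by (simp add: mult.assoc)
  then show ?thesis
    by (simp add: inv_of_right[OF b(2)])
qed

end
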